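(* Let $Y$ be a real Banach space, let $A:\ell^1\to Y$ be an injective and sequentially weak*-to-weak continuous bounded linear operator, and let $y^\dagger\in Y$ be such that $Ax=y^\dagger$ has a solution in $\ell^1$; denote this solution by $x^\dagger$. If $x^\dagger$ is sparse, then there is a constant $c$ such that $$\|x_\alpha^\delta-x^\dagger\|_{\ell^1}\le c\,\delta\qquad\text{for all }\delta>0,$$ if the regularization parameter $\alpha$ is chosen a priori $\alpha\sim\delta^{p-1}$ or by the discrepancy principle $\delta\le\|Ax_\alpha^\delta-y^\delta\|_Y\le\tau\delta$. The constant $c$ depends on the number of non-vanishing components of $x^\dagger$.
   Context: $\ell^1$ is the space of absolutely summable real sequences, regarded as the dual of $c_0$ (real sequences converging to zero); this defines weak* convergence in $\ell^1$. $A$ is sequentially weak*-to-weak continuous if it maps weak*-convergent sequences in $\ell^1$ to weakly convergent sequences in $Y$ (with the image of the limit as limit). A sequence is sparse if it has only finitely many non-zero components. For $\delta>0$, $y^\delta\in Y$ denotes noisy data with $\|y^\delta-y^\dagger\|_Y\le\delta$. For a fixed exponent $p>1$ and a regularization parameter $\alpha>0$, the Tikhonov functional is $$T_\alpha^\delta(x):=\|Ax-y^\delta\|_Y^p+\alpha\|x\|_{\ell^1},\qquad x\in\ell^1,$$ and $x_\alpha^\delta$ denotes a minimizer of $T_\alpha^\delta$ over $\ell^1$. The number $\tau\ge 1$ in the discrepancy principle is fixed. The a priori choice $\alpha\sim\delta^{p-1}$ means $c_1\delta^{p-1}\le\alpha\le c_2\delta^{p-1}$ with constants $c_1,c_2>0$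 independent of $\delta$.
   Formalization: The constant c is shown to depend on x† only through the set of indices of its non-vanishing components, not merely through their number; dependence on the number alone fails, e.g. for diagonal operators from ℓ¹ to ℓ² with entries tending to zero and x† = e_n. *)

theory Defs
  imports "HOL-Analysis.Analysis"
begin

typedef ell1 = "{x :: nat \<Rightarrow> real. summable (\<lambda>n. \<bar>x n\<bar>)}"
  morphisms coord Abs_ell1
  by (rule exI[of _ "\<lambda>_. 0"]) simp

setup_lifting type_definition_ell1

lemma summable_abs_coord: "summable (\<lambda>n. \<bar>coord x n\<bar>)"
  using coord[of x] by simp

lemma ell1_eqI: "(\<And>n. coord x n = coord y n) \<Longrightarrow> x = y"
  by (metis coord_inject ext)

lemma summable_abs_add:
  fixes f g :: "nat \<Rightarrow> real"
  assumes "summable (\<lambda>n. \<bar>f n\<bar>)" "summable (\<lambda>n. \<bar>g n\<bar>)"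
  shows "summable (\<lambda>n. \<bar>f n + g n\<bar>)"
  by (rule summable_comparison_test'[OF summable_add[OF assms], of 0]) (simp add: abs_triangle_ineq)

instantiation ell1 :: real_normed_vector
begin

lift_definition zero_ell1 :: ell1 is "\<lambda>_. 0" by simp

lift_definition plus_ell1 :: "ell1 \<Rightarrow> ell1 \<Rightarrow> ell1" is "\<lambda>x y n. x n + y n"
  by (rule summable_abs_add)

lift_definition uminus_ell1 :: "ell1 \<Rightarrow> ell1" is "\<lambda>x n. - x n"
  by simp

lift_definition minus_ell1 :: "ell1 \<Rightarrow> ell1 \<Rightarrow> ell1" is "\<lambda>x y n. x n - y n"
  using summable_abs_add[of _ "\<lambda>n. - _ n"] by simp

lift_definition scaleR_ell1 :: "real \<Rightarrow> ell1 \<Rightarrow> ell1" is "\<lambda>c x n. c * x n"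
  by (simp add: abs_mult summable_mult)

definition norm_ell1 :: "ell1 \<Rightarrow> real"
  where "norm_ell1 x = (\<Sum>n. \<bar>coord x n\<bar>)"

definition dist_ell1 :: "ell1 \<Rightarrow> ell1 \<Rightarrow> real"
  where "dist_ell1 x y = norm (x - y)"

definition sgn_ell1 :: "ell1 \<Rightarrow> ell1"
  where "sgn_ell1 x = inverse (norm x) *\<^sub>R x"

definition uniformity_ell1 :: "(ell1 \<times> ell1) filter"
  where "uniformity_ell1 = (INF e\<in>{0<..}. principal {(x, y). dist x y < e})"

definition open_ell1 :: "ell1 set \<Rightarrow> bool"
  where "open_ell1 U \<longleftrightarrow> (\<forall>x\<in>U. \<forall>\<^sub>F (x', y) in uniformity. x' = x \<longrightarrow> y \<in> U)"

instance
proof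
  fix x y z :: ell1 and a b :: real
  show "x + y + z = x + (y + z)" by transfer (simp add: add.assoc)
  show "x + y = y + x" by transfer (simp add: add.commute)
  show "0 + x = x" by transfer simp
  show "- x + x = 0" by transfer simp
  show "x - y = x + - y" by transfer simp
  show "a *\<^sub>R (x + y) = a *\<^sub>R x + a *\<^sub>R y" by transfer (simp add: distrib_left)
  show "(a + b) *\<^sub>R x = a *\<^sub>R x + b *\<^sub>R x" by transfer (simp add: distrib_right)
  show "a *\<^sub>R b *\<^sub>R x = (a * b) *\<^sub>R x" by transfer (simp add: mult.assoc)
  show "1 *\<^sub>R x = x" by transfer simp
  show "dist x y = norm (x - y)" by (rule dist_ell1_def)
  show "sgn x = inverse (norm x) *\<^sub>R x" by (rule sgn_ell1_def)
  show "(uniformity :: (ell1 \<times> ell1) filter) = (INF e\<in>{0<..}. principal {(x, y). dist x y < e})"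
    by (rule uniformity_ell1_def)
  show "open U \<longleftrightarrow> (\<forall>x\<in>U. \<forall>\<^sub>F (x', y) in uniformity. x' = x \<longrightarrow> y \<in> U)" for U :: "ell1 set"
    by (rule open_ell1_def)
  show "norm x = 0 \<longleftrightarrow> x = 0"
    using suminf_eq_zero_iff[OF summable_abs_coord[of x]]
    by (auto simp: norm_ell1_def zero_ell1.rep_eq intro: ell1_eqI)
  show "norm (x + y) \<le> norm x + norm y"
    unfolding norm_ell1_def plus_ell1.rep_eq
      suminf_add[OF summable_abs_coord summable_abs_coord]
    by (intro suminf_le abs_triangle_ineq summable_abs_add summable_add summable_abs_coord)
  show "norm (a *\<^sub>R x) = \<bar>a\<bar> * norm x"
    by (simp add: norm_ell1_def scaleR_ell1.rep_eq abs_mult suminf_mult summable_abs_coord)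
qed

end

definition supp :: "ell1 \<Rightarrow> nat set"
  where "supp x = {n. coord x n \<noteq> 0}"

definition sparse_seq :: "ell1 \<Rightarrow> bool"
  where "sparse_seq x \<longleftrightarrow> finite (supp x)"

text \<open>Every \<open>x\<close> in \<open>\<ell>\<^sup>1\<close> acts on \<open>z\<close> in \<open>c\<^sub>0\<close> by \<open>\<Sum>n. x n * z n\<close>, which identifies
  \<open>\<ell>\<^sup>1\<close> with the dual of \<open>c\<^sub>0\<close>; the series converges because \<open>z\<close> is bounded.\<close>

definition c0 :: "(nat \<Rightarrow> real) set"
  where "c0 = {z. z \<longlonglongrightarrow> 0}"

definition weakstar_conv :: "(nat \<Rightarrow> ell1) \<Rightarrow> ell1 \<Rightarrow> bool"
  where "weakstar_conv X x \<longleftrightarrow>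
    (\<forall>z\<in>c0. (\<lambda>k. \<Sum>n. coord (X k) n * z n) \<longlonglongrightarrow> (\<Sum>n. coord x n * z n))"

definition weakly_conv :: "(nat \<Rightarrow> 'a::real_normed_vector) \<Rightarrow> 'a \<Rightarrow> bool"
  where "weakly_conv Y y \<longleftrightarrow>
    (\<forall>f :: 'a \<Rightarrow> real. bounded_linear f \<longrightarrow> (\<lambda>k. f (Y k)) \<longlonglongrightarrow> f y)"

definition seq_weakstar_weak_continuous :: "(ell1 \<Rightarrow> 'a::real_normed_vector) \<Rightarrow> bool"
  where "seq_weakstar_weak_continuous A \<longleftrightarrow>
    (\<forall>X x. weakstar_conv X x \<longrightarrow> weakly_conv (\<lambda>k. A (X k)) (A x))"

definition tikhonov :: "(ell1 \<Rightarrow> 'a::real_normed_vector) \<Rightarrow> real \<Rightarrow> 'a \<Rightarrow> real \<Rightarrow> ell1 \<Rightarrow> real"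
  where "tikhonov A p y \<alpha> x = norm (A x - y) powr p + \<alpha> * norm x"

definition tikhonov_minimizer ::
    "(ell1 \<Rightarrow> 'a::real_normed_vector) \<Rightarrow> real \<Rightarrow> 'a \<Rightarrow> real \<Rightarrow> ell1 \<Rightarrow> bool"
  where "tikhonov_minimizer A p y \<alpha> x \<longleftrightarrow> is_arg_min (tikhonov A p y \<alpha>) (\<lambda>_. True) x"

definition apriori_choice :: "real \<Rightarrow> real \<Rightarrow> real \<Rightarrow> real \<Rightarrow> real \<Rightarrow> bool"
  where "apriori_choice c1 c2 p \<delta> \<alpha> \<longleftrightarrow>
    c1 * \<delta> powr (p - 1) \<le> \<alpha> \<and> \<alpha> \<le> c2 * \<delta> powr (p - 1)"

definition discrepancy_principle ::
    "(ell1 \<Rightarrow> 'a::real_normed_vector) \<Rightarrow> real \<Rightarrow> real \<Rightarrow> 'a \<Rightarrow> ell1 \<Rightarrow> bool"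
  where "discrepancy_principle A \<tau> \<delta> y x \<longleftrightarrow>
    \<delta> \<le> norm (A x - y) \<and> norm (A x - y) \<le> \<tau> * \<delta>"

end

theory Submission
  imports Defs
begin

text \<open>Let \<open>I\<close> be the support of the solution and \<open>h\<close> the error of a reconstruction. The key estimate
  bounds the part of \<open>h\<close> on \<open>I\<close> by \<open>\<theta> * norm h + C * norm (A h)\<close> with \<open>\<theta>\<close> as small as we please:
  if no \<open>C\<close> would do, normalized counterexamples would have a weak*-convergent subsequence whose limit
  is nonzero on \<open>I\<close> but is annihilated by \<open>A\<close>, since functionals separate points and \<open>A\<close> is
  weak*-to-weak continuous. With \<open>\<theta> = 1/3\<close> the estimate turns into the source condition
  \<open>norm h \<le> 3 * (norm x - norm x\<^sub>0) + 6 * C * norm (A h)\<close>, and minimality of \<open>x\<close> bounds the right-hand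
  side by a multiple of \<open>\<delta>\<close>. The functionals come from Hahn-Banach in this form: by Zorn's lemma
  there is a minimal sublinear functional below any given one, and minimal ones are linear.\<close>

section \<open>Sublinear functionals, Hahn-Banach and uniqueness of weak limits\<close>

text \<open>Homogeneity is asked only as an inequality. Applied with \<open>inverse s\<close> it
  yields equality, while infima need to be checked in one direction only.\<close>

definition sublinear :: "('a::real_vector \<Rightarrow> real) \<Rightarrow> bool"
  where "sublinear p \<longleftrightarrow> (\<forall>x y. p (x + y) \<le> p x + p y) \<and> (\<forall>x. \<forall>s>0. p (s *\<^sub>R x) \<le> s * p x)"

lemma sublinear_add: "sublinear p \<Longrightarrow> p (x + y) \<le> p x + p y"
  by (simp add: sublinear_def)

lemma sublinear_scaleR:
  assumes "sublinear p" "s > 0"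
  shows "p (s *\<^sub>R x) = s * p x"
proof (rule antisym)
  show "p (s *\<^sub>R x) \<le> s * p x"
    using assms by (simp add: sublinear_def)
  have "p (inverse s *\<^sub>R s *\<^sub>R x) \<le> inverse s * p (s *\<^sub>R x)"
    using assms unfolding sublinear_def by (meson positive_imp_inverse_positive)
  then show "s * p x \<le> p (s *\<^sub>R x)"
    using assms(2) by (simp add: field_simps)
qed

lemma sublinear_zero: "sublinear p \<Longrightarrow> p 0 = 0"
  using sublinear_scaleR[of p 2 0] by simp

lemma sublinear_minus: "sublinear p \<Longrightarrow> - p (- x) \<le> p x"
  using sublinear_add[of p x "- x"] sublinear_zero[of p] by simp

lemma sublinear_norm: "sublinear (norm :: 'a::real_normed_vector \<Rightarrow> real)"
  by (simp add: sublinear_def norm_triangle_ineq)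

text \<open>Applied to a minimal \<open>p\<close>, the bound at \<open>- y\<close> forces \<open>p (- y) = - p y\<close>; applied to the norm, it
  makes every functional below \<open>p'\<close> norming at \<open>y\<close>.\<close>

lemma sublinear_shrink:
  assumes p: "sublinear p"
  obtains p' where "sublinear p'" "\<And>x. p' x \<le> p x" "p' (- y) \<le> - p y"
proof -
  \<comment> \<open>Any sublinear \<open>g \<le> p\<close> with \<open>g (- y) \<le> - p y\<close>
    satisfies \<open>g x \<le> g (x + t *\<^sub>R y) + t * g (- y)\<close> and so lies below every
    term of this infimum: \<open>p'\<close> is the largest possible choice.\<close>
  define p' where "p' x = (INF t\<in>{0..}. p (x + t *\<^sub>R y) - t * p y)" for x
  have scale: "p (t *\<^sub>R y) = t * p y" if "t \<ge> 0" for t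
    using that sublinear_scaleR[OF p] sublinear_zero[OF p] by (cases "t = 0") auto
  have lower: "- p (- x) \<le> p (x + t *\<^sub>R y) - t * p y" if "t \<ge> 0" for x t
    using sublinear_add[OF p, of "x + t *\<^sub>R y" "- x"] scale[OF that] by simp
  have bdd: "bdd_below ((\<lambda>t. p (x + t *\<^sub>R y) - t * p y) ` {0..})" for x
    using lower by (intro bdd_belowI2[where m = "- p (- x)"]) auto
  have le: "p' x \<le> p (x + t *\<^sub>R y) - t * p y" if "t \<ge> 0" for x t
    unfolding p'_def using that by (intro cINF_lower bdd) simp
  have ge: "m \<le> p' x" if "\<And>t. t \<ge> 0 \<Longrightarrow> m \<le> p (x + t *\<^sub>R y) - t * p y" for m x
    unfolding p'_def using that by (intro cINF_greatest) auto
  have "sublinear p'"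
    unfolding sublinear_def
  proof (intro conjI allI impI)
    fix x z
    \<comment> \<open>The parameters \<open>s\<close> for \<open>x\<close> and \<open>t\<close> for
      \<open>z\<close> merge into \<open>s + t\<close> for \<open>x + z\<close>. The two infima are
      taken one after the other, first over \<open>s\<close>, then over \<open>t\<close>.\<close>
    have "p' (x + z) - (p (z + t *\<^sub>R y) - t * p y) \<le> p' x" if t: "t \<ge> 0" for t
    proof (rule ge)
      fix s :: real
      assume s: "s \<ge> 0"
      have "p' (x + z) \<le> p (x + z + (s + t) *\<^sub>R y) - (s + t) * p y"
        using s t by (intro le) simp
      also have "x + z + (s + t) *\<^sub>R y = (x + s *\<^sub>R y) + (z + t *\<^sub>R y)"
        by (simp add: algebra_simps)
      finally show "p' (x + z) - (p (z + t *\<^sub>R y) - t * p y) \<le> p (x + s *\<^sub>R y) - s * p y"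
        using sublinear_add[OF p, of "x + s *\<^sub>R y" "z + t *\<^sub>R y"] by (simp add: algebra_simps)
    qed
    then have "p' (x + z) - p' x \<le> p' z"
      by (intro ge) (simp add: algebra_simps)
    then show "p' (x + z) \<le> p' x + p' z"
      by simp
  next
    fix x and s :: real
    assume s: "s > 0"
    have "inverse s * p' (s *\<^sub>R x) \<le> p' x"
    proof (rule ge)
      fix t :: real
      assume "t \<ge> 0"
      then have "p' (s *\<^sub>R x) \<le> p (s *\<^sub>R x + (s * t) *\<^sub>R y) - s * t * p y"
        using s by (intro le) simp
      also have "s *\<^sub>R x + (s * t) *\<^sub>R y = s *\<^sub>R (x + t *\<^sub>R y)"
        by (simp add: algebra_simps)
      also have "p \<dots> = s * p (x + t *\<^sub>R y)"
        by (rule sublinear_scaleR[OF p s])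
      finally show "inverse s * p' (s *\<^sub>R x) \<le> p (x + t *\<^sub>R y) - t * p y"
        using s by (simp add: field_simps)
    qed
    then show "p' (s *\<^sub>R x) \<le> s * p' x"
      using s by (simp add: field_simps)
  qed
  moreover have "p' x \<le> p x" for x
    using le[of 0 x] by simp
  moreover have "p' (- y) \<le> - p y"
    using le[of 1 "- y"] sublinear_zero[OF p] by simp
  ultimately show ?thesis
    by (rule that)
qed

text \<open>The pointwise infimum works. The common bound \<open>q\<close> keeps it finite, since
  \<open>- q (- x) \<le> - p (- x) \<le> p x\<close>, and comparability lets a single member
  \<open>r\<close> replace two members in the proof of subadditivity.\<close>

lemma sublinear_Inf_chain:
  assumes ne: "C \<noteq> {}"
    and sub: "\<And>p. p \<in> C \<Longrightarrow> sublinear p \<and> p \<le> q"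
    and chain: "\<And>p p'. p \<in> C \<Longrightarrow> p' \<in> C \<Longrightarrow> p \<le> p' \<or> p' \<le> p"
  obtains u where "sublinear u" "\<And>p. p \<in> C \<Longrightarrow> u \<le> p"
proof -
  define u where "u x = (INF p\<in>C. p x)" for x
  have lower: "- q (- x) \<le> p x" if "p \<in> C" for p x
    using sublinear_minus[of p x] sub[OF that] by (fastforce simp: le_fun_def dest: spec[of _ "- x"])
  have le: "u x \<le> p x" if "p \<in> C" for p x
    unfolding u_def
    by (rule cINF_lower[OF _ that]) (use lower in \<open>auto intro: bdd_belowI2[where m = "- q (- x)"]\<close>)
  have ge: "m \<le> u x" if "\<And>p. p \<in> C \<Longrightarrow> m \<le> p x" for m x
    unfolding u_def using ne that by (intro cINF_greatest) auto
  have "sublinear u"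
    unfolding sublinear_def
  proof (intro conjI allI impI)
    fix x y
    have key: "u (x + y) \<le> p x + p' y" if pp': "p \<in> C" "p' \<in> C" for p p'
    proof -
      obtain r where r: "r \<in> C" "r \<le> p" "r \<le> p'"
        using chain[OF pp'] pp' by auto
      have "u (x + y) \<le> r (x + y)"
        by (rule le[OF r(1)])
      also have "\<dots> \<le> r x + r y"
        using sub[OF r(1)] by (simp add: sublinear_add)
      also have "\<dots> \<le> p x + p' y"
        using r by (auto simp: le_fun_def intro: add_mono)
      finally show ?thesis .
    qed
    have "u (x + y) - p' y \<le> u x" if "p' \<in> C" for p'
      using key that by (intro ge) (simp add: algebra_simps)
    then have "u (x + y) - u x \<le> u y"
      by (intro ge) (simp add: algebra_simps)
    then show "u (x + y) \<le> u x + u y"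
      by simp
  next
    fix x and s :: real
    assume s: "s > 0"
    have "inverse s * u (s *\<^sub>R x) \<le> u x"
    proof (rule ge)
      fix p
      assume "p \<in> C"
      then have "u (s *\<^sub>R x) \<le> s * p x"
        using le[of p "s *\<^sub>R x"] sub sublinear_scaleR[OF _ s, of p x] by auto
      then show "inverse s * u (s *\<^sub>R x) \<le> p x"
        using s by (simp add: field_simps)
    qed
    then show "u (s *\<^sub>R x) \<le> s * u x"
      using s by (simp add: field_simps)
  qed
  moreover have "u \<le> p" if "p \<in> C" for p
    using le[OF that] by (simp add: le_fun_def)
  ultimately show ?thesis
    by (rule that)
qed

lemma minimal_sublinear_exists:
  assumes q: "sublinear q"
  obtains m where "sublinear m" "m \<le> q" "\<And>p. sublinear p \<Longrightarrow> p \<le> m \<Longrightarrow> p = m"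
proof -
  let ?S = "{p. sublinear p \<and> p \<le> q}"
  have "\<exists>m\<in>?S. \<forall>a\<in>?S. a \<le> m \<longrightarrow> a = m"
  \<comment> \<open>Zorn's lemma produces maximal elements, hence the reversed order.\<close>
  proof (rule predicate_Zorn[where P = "\<lambda>p p'. p' \<le> p"])
    show "partial_order_on ?S (relation_of (\<lambda>p p'. p' \<le> p) ?S)"
      by (rule partial_order_on_relation_ofI) auto
  next
    fix C
    assume C: "C \<in> Chains (relation_of (\<lambda>p p'. p' \<le> p) ?S)"
    show "\<exists>u\<in>?S. \<forall>a\<in>C. u \<le> a"
    \<comment> \<open>The infimum is available for nonempty chains only; the empty chain is bounded
      by \<open>q\<close> itself.\<close>
    proof (cases "C = {}")
      case True
      then show ?thesis
        using q by auto
    next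
      case False
      have sub: "sublinear p \<and> p \<le> q" if "p \<in> C" for p
        using C that by (auto simp: Chains_def relation_of_def)
      have chain: "p \<le> p' \<or> p' \<le> p" if "p \<in> C" "p' \<in> C" for p p'
        using C that by (auto simp: Chains_def relation_of_def)
      obtain u where "sublinear u" "\<And>p. p \<in> C \<Longrightarrow> u \<le> p"
        using sublinear_Inf_chain[OF False sub chain] by blast
      then show ?thesis
        using False sub by (intro bexI[of _ u]) (auto intro: order_trans)
    qed
  qed
  then obtain m where m: "sublinear m" "m \<le> q" "\<And>p. sublinear p \<Longrightarrow> p \<le> q \<Longrightarrow> p \<le> m \<Longrightarrow> p = m"
    by auto
  then show ?thesis
    by (metis that order_trans)
qed

lemma minimal_sublinear_linear:
  assumes m: "sublinear m" and min: "\<And>p. sublinear p \<Longrightarrow> p \<le> m \<Longrightarrow> p = m"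
  shows "linear m"
proof -
  have minus: "m (- y) = - m y" for y
  proof -
    obtain p where "sublinear p" "\<And>x. p x \<le> m x" "p (- y) \<le> - m y"
      using sublinear_shrink[OF m, of y] by blast
    moreover from this have "p = m"
      by (intro min le_funI)
    ultimately have "m (- y) \<le> - m y"
      by blast
    then show ?thesis
      using sublinear_minus[OF m, of y] by simp
  qed
  show ?thesis
  proof (rule linearI)
    fix x y
    show "m (x + y) = m x + m y"
      \<comment> \<open>Subadditivity for \<open>(x + y) + (- y)\<close> turns, by oddness, into the
        reverse inequality \<open>m x + m y \<le> m (x + y)\<close>.\<close>
      using sublinear_add[OF m, of x y] sublinear_add[OF m, of "x + y" "- y"] minus[of y]
      by simp
  next
    fix s :: real and x
    consider "s > 0" | "s = 0" | "s < 0"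
      by linarith
    then show "m (s *\<^sub>R x) = s *\<^sub>R m x"
    proof cases
      case 1
      then show ?thesis
        by (simp add: sublinear_scaleR[OF m])
    next
      case 2
      then show ?thesis
        by (simp add: sublinear_zero[OF m])
    next
      case 3
      then have "m ((- s) *\<^sub>R x) = - s * m x"
        by (intro sublinear_scaleR[OF m]) simp
      then show ?thesis
        using minus[of "s *\<^sub>R x"] by simp
    qed
  qed
qed

lemma norming_functional:
  fixes y :: "'a::real_normed_vector"
  obtains f :: "'a \<Rightarrow> real" where "bounded_linear f" "f y = norm y" "\<And>x. \<bar>f x\<bar> \<le> norm x"
proof -
  obtain q :: "'a \<Rightarrow> real" where q: "sublinear q" "\<And>x. q x \<le> norm x" "q (- y) \<le> - norm y"
    using sublinear_shrink[OF sublinear_norm] by metis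
  obtain f where f: "sublinear f" "f \<le> q" "\<And>p. sublinear p \<Longrightarrow> p \<le> f \<Longrightarrow> p = f"
    using minimal_sublinear_exists[OF q(1)] by metis
  then have lin: "linear f"
    by (intro minimal_sublinear_linear)
  have le: "f x \<le> norm x" for x
    using f(2) q(2)[of x] by (auto simp: le_fun_def intro: order_trans)
  have abs: "\<bar>f x\<bar> \<le> norm x" for x
    using le[of x] le[of "- x"] linear_neg[OF lin, of x] by simp
  have "f (- y) \<le> - norm y"
    using f(2) q(3) by (auto simp: le_fun_def intro: order_trans)
  then have "f y = norm y"
    using le[of y] linear_neg[OF lin, of y] by simp
  moreover have "bounded_linear f"
    using lin abs by (auto intro: linear_conv_bounded_linear[THEN iffD1] bounded_linear_intro[of f 1]
        simp: linear_add linear_scale)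
  ultimately show ?thesis
    using abs by (intro that)
qed

text \<open>Norm convergence passes through every bounded functional, so one that norms
  \<open>x - y\<close> takes equal values at both limits, which forces
  \<open>norm (x - y) = 0\<close>.\<close>

lemma weakly_conv_unique:
  assumes "weakly_conv X x" "X \<longlonglongrightarrow> y"
  shows "x = y"
proof -
  obtain f :: "'a \<Rightarrow> real" where f: "bounded_linear f" "f (x - y) = norm (x - y)"
    using norming_functional by metis
  have "(\<lambda>k. f (X k)) \<longlonglongrightarrow> f x"
    using assms(1) f(1) by (simp add: weakly_conv_def)
  moreover have "(\<lambda>k. f (X k)) \<longlonglongrightarrow> f y"
    using f(1) assms(2) by (rule bounded_linear.tendsto)
  ultimately have "f x = f y"
    by (rule LIMSEQ_unique)
  then show ?thesis
    using f linear_diff[OF bounded_linear.linear[OF f(1)]] by simp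
qed

section \<open>Weak* convergence and sequential compactness of bounded sets\<close>

lemma sum_abs_coord_le_norm: "finite I \<Longrightarrow> (\<Sum>n\<in>I. \<bar>coord x n\<bar>) \<le> norm x"
  unfolding norm_ell1_def by (intro sum_le_suminf summable_abs_coord) auto

lemma ell1_of_bounded_partial_sums:
  assumes "\<And>N. (\<Sum>n<N. \<bar>f n\<bar>) \<le> M"
  obtains x where "coord x = f" "norm x \<le> M"
proof -
  have sum: "summable (\<lambda>n. \<bar>f n\<bar>)"
    using assms[of "Suc _"] by (intro bounded_imp_summable[where B = M])
      (simp_all only: lessThan_Suc_atMost abs_ge_zero)
  then have "coord (Abs_ell1 f) = f"
    by (simp add: Abs_ell1_inverse)
  moreover from this have "norm (Abs_ell1 f) \<le> M"
    using sum assms by (auto simp: norm_ell1_def intro: suminf_le_const)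
  ultimately show ?thesis
    by (rule that)
qed

lemma summable_pairing:
  assumes "z \<in> c0"
  shows "summable (\<lambda>n. \<bar>coord x n * z n\<bar>)"
proof -
  have "Bseq z"
    using assms by (intro convergent_imp_Bseq) (auto simp: c0_def intro: convergentI)
  then obtain B where B: "\<And>n. \<bar>z n\<bar> \<le> B"
    by (auto simp: Bseq_def)
  show ?thesis
  proof (rule summable_comparison_test'[OF summable_mult[OF summable_abs_coord]])
    show "norm \<bar>coord x n * z n\<bar> \<le> B * \<bar>coord x n\<bar>" for n
      using mult_right_mono[OF B abs_ge_zero, of n "coord x n"] by (simp add: abs_mult mult.commute)
  qed
qed

text \<open>Splitting at \<open>N\<close> separates a finite head, where coordinatewise convergence
  suffices, from a tail that is small uniformly on bounded sets because \<open>z\<close> is small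
  there.\<close>

lemma pairing_bound:
  assumes z: "z \<in> c0" and small: "\<And>n. n \<ge> N \<Longrightarrow> \<bar>z n\<bar> \<le> e" and "e \<ge> 0"
  shows "\<bar>\<Sum>n. coord x n * z n\<bar> \<le> (\<Sum>n<N. \<bar>coord x n * z n\<bar>) + e * norm x"
proof -
  have "\<bar>\<Sum>n. coord x n * z n\<bar> \<le> (\<Sum>n. \<bar>coord x n * z n\<bar>)"
    by (rule summable_rabs[OF summable_pairing[OF z]])
  also have "\<dots> = (\<Sum>n. \<bar>coord x (n + N) * z (n + N)\<bar>) + (\<Sum>n<N. \<bar>coord x n * z n\<bar>)"
    by (rule suminf_split_initial_segment[OF summable_pairing[OF z]])
  also have "(\<Sum>n. \<bar>coord x (n + N) * z (n + N)\<bar>) \<le> (\<Sum>n. e * \<bar>coord x (n + N)\<bar>)"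
  proof (intro suminf_le summable_mult)
    show "\<bar>coord x (n + N) * z (n + N)\<bar> \<le> e * \<bar>coord x (n + N)\<bar>" for n
      using mult_right_mono[OF small[of "n + N"], of "\<bar>coord x (n + N)\<bar>"]
      by (simp add: abs_mult mult.commute)
    show "summable (\<lambda>n. \<bar>coord x (n + N) * z (n + N)\<bar>)"
      by (rule summable_ignore_initial_segment[OF summable_pairing[OF z]])
    show "summable (\<lambda>n. \<bar>coord x (n + N)\<bar>)"
      by (rule summable_ignore_initial_segment[OF summable_abs_coord])
  qed
  also have "\<dots> = e * (\<Sum>n. \<bar>coord x (n + N)\<bar>)"
    by (rule suminf_mult[OF summable_ignore_initial_segment[OF summable_abs_coord]])
  also have "(\<Sum>n. \<bar>coord x (n + N)\<bar>) \<le> norm x"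
    unfolding norm_ell1_def
    using suminf_split_initial_segment[OF summable_abs_coord[of x], of N]
    by (simp add: sum_nonneg)
  finally show ?thesis
    using \<open>e \<ge> 0\<close> by (simp add: mult_left_mono)
qed

lemma weakstar_convI:
  assumes coord: "\<And>n. (\<lambda>k. coord (X k) n) \<longlonglongrightarrow> coord x n"
    and bound: "\<And>k. norm (X k) \<le> M"
  shows "weakstar_conv X x"
  unfolding weakstar_conv_def
proof
  fix z
  assume z: "z \<in> c0"
  have M: "0 \<le> M"
    using bound[of 0] norm_ge_zero order_trans by blast
  have diff: "(\<Sum>n. coord u n * z n) - (\<Sum>n. coord v n * z n) = (\<Sum>n. coord (u - v) n * z n)" for u v
    using suminf_diff[OF summable_rabs_cancel[OF summable_pairing[OF z]]
        summable_rabs_cancel[OF summable_pairing[OF z]], of u v]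
    by (simp add: minus_ell1.rep_eq left_diff_distrib)
  show "(\<lambda>k. \<Sum>n. coord (X k) n * z n) \<longlonglongrightarrow> (\<Sum>n. coord x n * z n)"
  proof (rule LIMSEQ_I)
    fix r :: real
    assume r: "r > 0"
    \<comment> \<open>\<open>D\<close> exceeds every \<open>norm (X k - x)\<close>, with the summand
      1 keeping it positive. As \<open>e * D = r / 2\<close>, the other half of \<open>r\<close> is
      left for the finite head.\<close>
    define D where "D = M + norm x + 1"
    have D: "D > 0"
      using M by (simp add: D_def add_nonneg_pos)
    define e where "e = r / (2 * D)"
    have e: "e > 0"
      using r D by (simp add: e_def)
    obtain N where N: "\<And>n. n \<ge> N \<Longrightarrow> \<bar>z n\<bar> \<le> e"
      using z LIMSEQ_D[of z 0 e] e by (force simp: c0_def)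
    have "(\<lambda>k. \<Sum>n<N. \<bar>coord (X k - x) n * z n\<bar>) \<longlonglongrightarrow> (\<Sum>n<N. \<bar>(coord x n - coord x n) * z n\<bar>)"
      unfolding minus_ell1.rep_eq by (intro tendsto_intros coord)
    then obtain K where K: "\<And>k. k \<ge> K \<Longrightarrow> (\<Sum>n<N. \<bar>coord (X k - x) n * z n\<bar>) < r / 2"
      using LIMSEQ_D[of _ 0 "r / 2"] r by (force simp: sum_nonneg)
    show "\<exists>K. \<forall>k\<ge>K. norm ((\<Sum>n. coord (X k) n * z n) - (\<Sum>n. coord x n * z n)) < r"
    proof (intro exI allI impI)
      fix k
      assume "k \<ge> K"
      have "norm (X k - x) \<le> D"
        using norm_triangle_ineq4[of "X k" x] bound[of k] by (simp add: D_def)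
      then have "e * norm (X k - x) \<le> e * D"
        using e by simp
      also have "e * D = r / 2"
        using D by (simp add: e_def)
      finally show "norm ((\<Sum>n. coord (X k) n * z n) - (\<Sum>n. coord x n * z n)) < r"
        unfolding diff
        using pairing_bound[OF z N, of N "X k - x"] K[OF \<open>k \<ge> K\<close>] e by simp
    qed
  qed
qed

text \<open>Sequential Banach-Alaoglu via Tychonoff: the coordinates live in a countable product of
  compact intervals, which is first countable and hence sequentially compact. The pointwise limit is
  again absolutely summable because its partial sums inherit the bound \<open>M\<close>.\<close>

lemma weakstar_convergent_subseq:
  assumes bound: "\<And>k. norm (X k) \<le> M"
  obtains x r where "strict_mono (r :: nat \<Rightarrow> nat)" "weakstar_conv (X \<circ> r) x"
    "\<And>n. (\<lambda>k. coord (X (r k)) n) \<longlonglongrightarrow> coord x n"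
proof -
  have abs_le: "\<bar>coord (X k) n\<bar> \<le> M" for k n
    using sum_abs_coord_le_norm[of "{n}" "X k"] bound[of k] by simp
  let ?P = "PiE UNIV (\<lambda>_. cball 0 M) :: (nat \<Rightarrow> real) set"
  have "compactin (product_topology (\<lambda>_. euclidean) UNIV) ?P"
    by (simp add: compactin_PiE)
  then have "seq_compact ?P"
    by (simp add: euclidean_product_topology compact_imp_seq_compact)
  moreover have "coord (X k) \<in> ?P" for k
    using abs_le[of k] by auto
  ultimately obtain f r where r: "strict_mono (r :: nat \<Rightarrow> nat)" "((\<lambda>k. coord (X k)) \<circ> r) \<longlonglongrightarrow> f"
    unfolding seq_compact_def by metis
  have lim: "(\<lambda>k. coord (X (r k)) n) \<longlonglongrightarrow> f n" for n
    using continuous_on_tendsto_compose[OF continuous_on_product_coordinates[of n] r(2)]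
    by simp
  have "(\<Sum>n<N. \<bar>f n\<bar>) \<le> M" for N
  proof (rule LIMSEQ_le_const2)
    show "(\<lambda>k. \<Sum>n<N. \<bar>coord (X (r k)) n\<bar>) \<longlonglongrightarrow> (\<Sum>n<N. \<bar>f n\<bar>)"
      by (intro tendsto_intros lim)
    show "\<exists>K. \<forall>k\<ge>K. (\<Sum>n<N. \<bar>coord (X (r k)) n\<bar>) \<le> M"
      using order_trans[OF sum_abs_coord_le_norm bound] by blast
  qed
  then obtain x where "coord x = f"
    by (rule ell1_of_bounded_partial_sums)
  then show ?thesis
    using lim r(1) bound by (intro that[of r x] weakstar_convI[where M = M]) auto
qed

section \<open>Control of finitely many coordinates and the source condition\<close>

lemma sum_abs_coord_le_norm_image:
  fixes A :: "ell1 \<Rightarrow> 'y::real_normed_vector"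
  assumes A: "bounded_linear A" and inj: "inj A" and cont: "seq_weakstar_weak_continuous A"
    and I: "finite I" and \<theta>: "\<theta> > 0"
  obtains C where "C > 0" "\<And>h. (\<Sum>n\<in>I. \<bar>coord h n\<bar>) \<le> \<theta> * norm h + C * norm (A h)"
proof -
  interpret A: bounded_linear A
    by (rule A)
  define s where "s h = (\<Sum>n\<in>I. \<bar>coord h n\<bar>)" for h
  have "\<exists>C>0. \<forall>h. s h \<le> \<theta> * norm h + C * norm (A h)"
  proof (rule ccontr)
    assume neg: "\<not> ?thesis"
    \<comment> \<open>The failing inequality for the constant \<open>Suc k\<close> is homogeneous in
      \<open>h\<close>, so its counterexample can be scaled to norm 1. Since \<open>s\<close> is
      then at most 1, the image has norm at most \<open>inverse (real (Suc k))\<close>.\<close>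
    have "\<exists>h. norm h = 1 \<and> \<theta> \<le> s h \<and> norm (A h) \<le> inverse (real (Suc k))" for k
    proof -
      obtain h where h: "s h > \<theta> * norm h + real (Suc k) * norm (A h)"
        using neg by (metis not_le of_nat_0_less_iff zero_less_Suc)
      have s_zero: "s 0 = 0"
        by (simp add: s_def zero_ell1.rep_eq)
      have "h \<noteq> 0"
        using h s_zero by (auto simp: A.zero)
      define u where "u = inverse (norm h) *\<^sub>R h"
      have nu: "norm u = 1"
        using \<open>h \<noteq> 0\<close> by (simp add: u_def)
      have su: "s u = inverse (norm h) * s h"
        by (simp add: s_def u_def scaleR_ell1.rep_eq abs_mult sum_distrib_left)
      have Au: "norm (A u) = inverse (norm h) * norm (A h)"
        by (simp add: u_def A.scaleR)
      have gt: "s u > \<theta> + real (Suc k) * norm (A u)"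
      proof -
        have "\<theta> + real (Suc k) * norm (A u) = inverse (norm h) * (\<theta> * norm h + real (Suc k) * norm (A h))"
          using \<open>h \<noteq> 0\<close> unfolding Au by (simp add: distrib_left del: of_nat_Suc)
        also have "\<dots> < s u"
          unfolding su using h \<open>h \<noteq> 0\<close> by (intro mult_strict_left_mono) auto
        finally show ?thesis .
      qed
      have "s u \<le> 1"
        using sum_abs_coord_le_norm[OF I, of u] nu by (simp add: s_def)
      then have "real (Suc k) * norm (A u) \<le> 1"
        using gt \<theta> by linarith
      moreover have "\<theta> \<le> s u"
      proof -
        have "0 \<le> real (Suc k) * norm (A u)"
          by simp
        then show ?thesis
          using gt by linarith
      qed
      ultimately show ?thesis
        using nu by (intro exI[of _ u]) (simp add: field_simps)
    qed
    then obtain X where X: "\<And>k. norm (X k) = 1" "\<And>k. \<theta> \<le> s (X k)"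
      "\<And>k. norm (A (X k)) \<le> inverse (real (Suc k))"
      by metis
    obtain x r where r: "strict_mono (r :: nat \<Rightarrow> nat)" "weakstar_conv (X \<circ> r) x"
      "\<And>n. (\<lambda>k. coord (X (r k)) n) \<longlonglongrightarrow> coord x n"
    proof (rule weakstar_convergent_subseq[of X 1])
      show "norm (X k) \<le> 1" for k
        by (simp add: X(1))
    qed (rule that)
    \<comment> \<open>As a finite sum of coordinates, \<open>s\<close> passes to the limit, whereas
      the norm itself may drop under weak* convergence.\<close>
    have "(\<lambda>k. s (X (r k))) \<longlonglongrightarrow> s x"
      unfolding s_def by (intro tendsto_intros r)
    then have "\<theta> \<le> s x"
      by (rule LIMSEQ_le_const) (simp add: X(2))
    have "(\<lambda>k. A (X k)) \<longlonglongrightarrow> 0"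
      by (rule Lim_null_comparison[OF _ LIMSEQ_inverse_real_of_nat]) (intro always_eventually allI X(3))
    from LIMSEQ_subseq_LIMSEQ[OF this r(1)] have "(\<lambda>k. A ((X \<circ> r) k)) \<longlonglongrightarrow> 0"
      by (simp add: comp_def)
    moreover have "weakly_conv (\<lambda>k. A ((X \<circ> r) k)) (A x)"
      using cont r(2) unfolding seq_weakstar_weak_continuous_def by blast
    ultimately have "A x = 0"
      by (intro weakly_conv_unique)
    then have "x = 0"
      using injD[OF inj, of x 0] by (simp add: A.zero)
    then show False
      using \<open>\<theta> \<le> s x\<close> \<theta> by (simp add: s_def zero_ell1.rep_eq)
  qed
  then show ?thesis
    using that by (auto simp: s_def)
qed

text \<open>The comparison is termwise: off the support of \<open>x\<^sub>0\<close> both sides equal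
  \<open>\<bar>coord x n\<bar>\<close>, and on it the triangle inequality bounds
  \<open>\<bar>coord x\<^sub>0 n\<bar>\<close>.\<close>

lemma norm_diff_supp_le:
  assumes "finite (supp x\<^sub>0)"
  shows "norm (x - x\<^sub>0) \<le> norm x - norm x\<^sub>0 + 2 * (\<Sum>n\<in>supp x\<^sub>0. \<bar>coord (x - x\<^sub>0) n\<bar>)"
proof -
  let ?g = "\<lambda>n. if n \<in> supp x\<^sub>0 then \<bar>coord (x - x\<^sub>0) n\<bar> else 0"
  have g: "?g sums (\<Sum>n\<in>supp x\<^sub>0. \<bar>coord (x - x\<^sub>0) n\<bar>)"
    by (rule sums_If_finite_set[OF assms])
  have norm: "(\<lambda>n. \<bar>coord u n\<bar>) sums norm u" for u
    unfolding norm_ell1_def by (rule summable_sums[OF summable_abs_coord])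
  show ?thesis
  proof (rule sums_le)
    show "(\<lambda>n. \<bar>coord (x - x\<^sub>0) n\<bar>) sums norm (x - x\<^sub>0)"
      by (rule norm)
    show "(\<lambda>n. \<bar>coord x n\<bar> - \<bar>coord x\<^sub>0 n\<bar> + 2 * ?g n) sums
        (norm x - norm x\<^sub>0 + 2 * (\<Sum>n\<in>supp x\<^sub>0. \<bar>coord (x - x\<^sub>0) n\<bar>))"
      by (intro sums_add sums_diff sums_mult norm g)
    show "\<bar>coord (x - x\<^sub>0) n\<bar> \<le> \<bar>coord x n\<bar> - \<bar>coord x\<^sub>0 n\<bar> + 2 * ?g n" for n
      by (auto simp: supp_def minus_ell1.rep_eq)
  qed
qed

lemma source_condition:
  fixes A :: "ell1 \<Rightarrow> 'y::real_normed_vector"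
  assumes "bounded_linear A" "inj A" "seq_weakstar_weak_continuous A" "finite I"
  obtains C where "C > 0"
    "\<And>x x\<^sub>0. supp x\<^sub>0 = I \<Longrightarrow> norm (x - x\<^sub>0) \<le> 3 * (norm x - norm x\<^sub>0) + C * norm (A (x - x\<^sub>0))"
proof -
  \<comment> \<open>Through the factor 2 in \<open>norm_diff_supp_le\<close>, the weight 1/3 puts
    two thirds of \<open>norm (x - x\<^sub>0)\<close> on the right. Absorbing them leaves one third
    on the left, hence the factors 3 and \<open>6 * C\<close>.\<close>
  obtain C where C: "C > 0" "\<And>h. (\<Sum>n\<in>I. \<bar>coord h n\<bar>) \<le> 1/3 * norm h + C * norm (A h)"
    using sum_abs_coord_le_norm_image[OF assms, of "1/3"] by auto
  have "norm (x - x\<^sub>0) \<le> 3 * (norm x - norm x\<^sub>0) + 6 * C * norm (A (x - x\<^sub>0))" if "supp x\<^sub>0 = I" for x x\<^sub>0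
    using norm_diff_supp_le[of x\<^sub>0 x] C(2)[of "x - x\<^sub>0"] that assms(4) by simp
  then show ?thesis
    using C(1) by (intro that[of "6 * C"]) auto
qed

section \<open>Parameter choice and the convergence rate\<close>

text \<open>For \<open>r\<close> above \<open>(C * c2) powr (1 / (p - 1)) * \<delta>\<close> the term \<open>r powr p / \<alpha>\<close> absorbs \<open>C * r\<close>.\<close>

lemma residual_tradeoff:
  fixes c1 c2 C p \<alpha> \<delta> r :: real
  assumes "p > 1" "c1 > 0" "c2 > 0" "C > 0" "\<delta> > 0" "r \<ge> 0"
    and \<alpha>: "c1 * \<delta> powr (p - 1) \<le> \<alpha>" "\<alpha> \<le> c2 * \<delta> powr (p - 1)"
  shows "(\<delta> powr p - r powr p) / \<alpha> + C * r \<le> (1 / c1 + C * (C * c2) powr (1 / (p - 1))) * \<delta>"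
proof -
  define K where "K = (C * c2) powr (1 / (p - 1))"
  have K: "K > 0" "K powr (p - 1) = C * c2"
    using assms by (auto simp: K_def powr_powr)
  have pos: "\<alpha> > 0"
    using \<alpha>(1) assms by (smt (verit) mult_pos_pos powr_gt_zero)
  have split: "t powr p = t powr (p - 1) * t" if "t \<ge> 0" for t :: real
    using that powr_mult_base[of t "p - 1"] by (simp add: mult.commute)
  \<comment> \<open>The lower bound on \<alpha> controls the noise term; the upper bound serves the
    residual term afterwards.\<close>
  have "\<delta> powr p * c1 \<le> \<delta> * \<alpha>"
    using mult_left_mono[OF \<alpha>(1), of \<delta>] assms split[of \<delta>] by (simp add: mult_ac)
  then have 1: "\<delta> powr p / \<alpha> \<le> 1 / c1 * \<delta>"
    using pos assms by (simp add: field_simps)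
  have 2: "C * r - r powr p / \<alpha> \<le> C * K * \<delta>"
  proof (cases "r \<le> K * \<delta>")
    case True
    then have "C * r \<le> C * K * \<delta>"
      using assms by simp
    moreover have "r powr p / \<alpha> \<ge> 0"
      using pos by simp
    ultimately show ?thesis
      by linarith
  next
    case False
    have "C * \<alpha> \<le> C * c2 * \<delta> powr (p - 1)"
      using \<alpha>(2) assms by simp
    also have "\<dots> = (K * \<delta>) powr (p - 1)"
      using K assms by (simp add: powr_mult)
    also have "\<dots> \<le> r powr (p - 1)"
      using False K assms by (intro powr_mono2) auto
    finally have "C * \<alpha> * r \<le> r powr p"
      using split[of r] assms by (simp add: mult_right_mono)
    then have "C * r \<le> r powr p / \<alpha>"
      using pos by (simp add: field_simps)
    moreover have "C * K * \<delta> \<ge> 0"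
      using assms K by simp
    ultimately show ?thesis
      by linarith
  qed
  show ?thesis
    using 1 2 by (simp add: K_def[symmetric] diff_divide_distrib distrib_right)
qed

text \<open>The Tikhonov value of the minimizer is compared with that of \<open>x\<^sub>0\<close>,
  whose misfit is at most \<open>\<delta> powr p\<close>.\<close>

lemma minimizer_norm_diff_le:
  assumes min: "tikhonov_minimizer A p y \<alpha> x" and "\<alpha> > 0" "p > 1" and noise: "norm (A x\<^sub>0 - y) \<le> \<delta>"
  shows "norm x - norm x\<^sub>0 \<le> (\<delta> powr p - norm (A x - y) powr p) / \<alpha>"
proof -
  have "tikhonov A p y \<alpha> x \<le> tikhonov A p y \<alpha> x\<^sub>0"
    using min by (auto simp: tikhonov_minimizer_def is_arg_min_def not_less)
  moreover have "norm (A x\<^sub>0 - y) powr p \<le> \<delta> powr p"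
    using noise assms(3) by (intro powr_mono2) auto
  ultimately show ?thesis
    using \<open>\<alpha> > 0\<close> by (simp add: tikhonov_def field_simps)
qed

lemma convergence_rate:
  fixes A :: "ell1 \<Rightarrow> 'y::real_normed_vector"
  assumes A: "bounded_linear A" "inj A" "seq_weakstar_weak_continuous A"
    and p: "p > 1" and c: "c1 > 0" "c2 > 0" and I: "finite I"
  obtains c where "\<And>x\<^sub>0 \<delta> y \<alpha> x. supp x\<^sub>0 = I \<Longrightarrow> \<delta> > 0 \<Longrightarrow> norm (y - A x\<^sub>0) \<le> \<delta> \<Longrightarrow> \<alpha> > 0 \<Longrightarrow>
    tikhonov_minimizer A p y \<alpha> x \<Longrightarrow>
    apriori_choice c1 c2 p \<delta> \<alpha> \<or> discrepancy_principle A \<tau> \<delta> y x \<Longrightarrow> norm (x - x\<^sub>0) \<le> c * \<delta>"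
proof -
  obtain C where C: "C > 0"
    "\<And>x x\<^sub>0. supp x\<^sub>0 = I \<Longrightarrow> norm (x - x\<^sub>0) \<le> 3 * (norm x - norm x\<^sub>0) + C * norm (A (x - x\<^sub>0))"
    using source_condition[OF A I] by blast
  \<comment> \<open>\<open>L\<close> is the constant of \<open>residual_tradeoff\<close> with
    \<open>C / 3\<close> for \<open>C\<close>, because the bound
    \<open>3 * D + C * (r + \<delta>)\<close> below equals
    \<open>3 * (D + C / 3 * r) + C * \<delta>\<close>.\<close>
  define L where "L = 1 / c1 + C / 3 * (C / 3 * c2) powr (1 / (p - 1))"
  define c_apriori where "c_apriori = 3 * L + C"
  define c_discr where "c_discr = C * (\<tau> + 1)"
  have "norm (x - x\<^sub>0) \<le> max c_apriori c_discr * \<delta>"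
    if supp: "supp x\<^sub>0 = I" and \<delta>: "\<delta> > 0" and noise: "norm (y - A x\<^sub>0) \<le> \<delta>" and \<alpha>: "\<alpha> > 0"
      and min: "tikhonov_minimizer A p y \<alpha> x"
      and choice: "apriori_choice c1 c2 p \<delta> \<alpha> \<or> discrepancy_principle A \<tau> \<delta> y x"
    for x\<^sub>0 \<delta> y \<alpha> x
  proof -
    define r where "r = norm (A x - y)"
    define D where "D = (\<delta> powr p - r powr p) / \<alpha>"
    have D: "norm x - norm x\<^sub>0 \<le> D"
      using minimizer_norm_diff_le[OF min \<alpha> p, of x\<^sub>0 \<delta>] noise
      by (simp add: D_def r_def norm_minus_commute)
    have "norm (A (x - x\<^sub>0)) \<le> r + \<delta>"
      using norm_triangle_ineq[of "A x - y" "y - A x\<^sub>0"] noise linear_diff[OF bounded_linear.linear[OF A(1)]]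
      by (simp add: r_def)
    then have "C * norm (A (x - x\<^sub>0)) \<le> C * (r + \<delta>)"
      using C(1) by simp
    then have main: "norm (x - x\<^sub>0) \<le> 3 * D + C * (r + \<delta>)"
      using D by (intro order_trans[OF C(2)[OF supp]] add_mono) auto
    from choice show ?thesis
    proof
      assume "apriori_choice c1 c2 p \<delta> \<alpha>"
      then have "D + C / 3 * r \<le> L * \<delta>"
        unfolding D_def L_def using p c C \<delta>
        by (intro residual_tradeoff) (auto simp: apriori_choice_def r_def)
      then have "3 * D + C * (r + \<delta>) \<le> c_apriori * \<delta>"
        unfolding c_apriori_def by (simp add: algebra_simps)
      also have "\<dots> \<le> max c_apriori c_discr * \<delta>"
        using \<delta> by (intro mult_right_mono) auto
      finally show ?thesis
        using main by linarith
    next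
      assume discr: "discrepancy_principle A \<tau> \<delta> y x"
      then have r: "\<delta> \<le> r" "r \<le> \<tau> * \<delta>"
        by (auto simp: discrepancy_principle_def r_def)
      \<comment> \<open>A residual of at least \<delta> means that the minimizer has no larger norm
        than \<open>x\<^sub>0\<close>, so only the term with \<open>C\<close> remains, and the upper
        bound on the residual controls it.\<close>
      have "\<delta> powr p \<le> r powr p"
        using r(1) \<delta> p by (intro powr_mono2) auto
      then have "D \<le> 0"
        using \<alpha> by (simp add: D_def divide_le_0_iff)
      moreover have "C * (r + \<delta>) \<le> c_discr * \<delta>"
        unfolding c_discr_def using r(2) C(1) by (simp add: algebra_simps)
      moreover have "c_discr * \<delta> \<le> max c_apriori c_discr * \<delta>"
        using \<delta> by (intro mult_right_mono) auto
      ultimately show ?thesis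
        using main by linarith
    qed
  qed
  then show ?thesis
    by (rule that)
qed

theorem corollary2:
  fixes A :: "ell1 \<Rightarrow> 'y::banach"
    and p \<tau> c1 c2 :: real
  assumes "bounded_linear A"
    and "inj A"
    and "seq_weakstar_weak_continuous A"
    and "p > 1"
    and "\<tau> \<ge> 1"
    and "c1 > 0" and "c2 > 0"
  shows "\<exists>c :: nat set \<Rightarrow> real.
    \<forall>y\<^sub>0 x\<^sub>0. A x\<^sub>0 = y\<^sub>0 \<longrightarrow> sparse_seq x\<^sub>0 \<longrightarrow>
      (\<forall>\<delta>>0. \<forall>y\<^sub>\<delta> \<alpha> x.
        norm (y\<^sub>\<delta> - y\<^sub>0) \<le> \<delta> \<longrightarrow>
        \<alpha> > 0 \<longrightarrow>
        tikhonov_minimizer A p y\<^sub>\<delta> \<alpha> x \<longrightarrow>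
        apriori_choice c1 c2 p \<delta> \<alpha> \<or> discrepancy_principle A \<tau> \<delta> y\<^sub>\<delta> x \<longrightarrow>
        norm (x - x\<^sub>0) \<le> c (supp x\<^sub>0) * \<delta>)"
proof -
  \<comment> \<open>Finiteness of \<open>I\<close> stands under the quantifier for \<open>c\<close>,
    so that choice over all sets yields a total function of the support, with arbitrary values on
    infinite sets.\<close>
  have "\<exists>c. finite I \<longrightarrow> (\<forall>x\<^sub>0 \<delta> y \<alpha> x. supp x\<^sub>0 = I \<longrightarrow> \<delta> > 0 \<longrightarrow> norm (y - A x\<^sub>0) \<le> \<delta> \<longrightarrow> \<alpha> > 0 \<longrightarrow>
      tikhonov_minimizer A p y \<alpha> x \<longrightarrow>
      apriori_choice c1 c2 p \<delta> \<alpha> \<or> discrepancy_principle A \<tau> \<delta> y x \<longrightarrow> norm (x - x\<^sub>0) \<le> c * \<delta>)" for I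
    using convergence_rate[OF assms(1-4,6,7)] by metis
  then obtain c where "\<And>I x\<^sub>0 \<delta> y \<alpha> x. finite I \<Longrightarrow> supp x\<^sub>0 = I \<Longrightarrow> \<delta> > 0 \<Longrightarrow> norm (y - A x\<^sub>0) \<le> \<delta> \<Longrightarrow>
      \<alpha> > 0 \<Longrightarrow> tikhonov_minimizer A p y \<alpha> x \<Longrightarrow>
      apriori_choice c1 c2 p \<delta> \<alpha> \<or> discrepancy_principle A \<tau> \<delta> y x \<Longrightarrow> norm (x - x\<^sub>0) \<le> c I * \<delta>"
    by metis
  then show ?thesis
    unfolding sparse_seq_def by blast
qed

end
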